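(* Let $a,b,c\in\mathbb{R}$ with $b<a^2/3$, and let $c_0=-\frac{2}{27}a^3+\frac13 ab$, $c_1=c_0+\frac{2}{27}\sqrt{(a^2-3b)^3}$, $c_2=c_0-\frac{2}{27}\sqrt{(a^2-3b)^3}$. Let $\mu_1=-\frac a3+\frac13\sqrt{a^2-3b}$ and $\mu_2=-\frac a3-\frac13\sqrt{a^2-3b}$. Consider $p(x)=x^3+ax^2+bx+c$. (I) If $c<c_2$, then $p$ has only one real root $x_1$, and $x_1>\xi_2$, where $\xi_2=-a-2\mu_2=-\frac a3+\frac23\sqrt{a^2-3b}$. (II) If $c>c_1$, then $p$ has only one real root $x_1$, and $x_1<\xi_1$, where $\xi_1=-a-2\mu_1=-\frac a3-\frac23\sqrt{a^2-3b}$.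
   Context: All coefficients are real. "Only one real root" means that the other two complex roots of $p$ form a pair of non-real complex conjugates. *)

theory Defs
  imports Complex_Main "HOL-Computational_Algebra.Computational_Algebra"
begin

text \<open>
  For a real cubic \<^term>\<open>p\<close>: the number \<^term>\<open>x1\<close> is its only real root, and the other two
  complex roots form a pair of non-real complex conjugates.  Complex roots are counted with
  multiplicity, so \<^term>\<open>x1\<close> is in particular a simple root.
\<close>
definition only_one_real_root :: "real poly \<Rightarrow> real \<Rightarrow> bool" where
  "only_one_real_root p x1 \<longleftrightarrow>
     {x. poly p x = 0} = {x1} \<and>
     (\<exists>z. z \<notin> \<real> \<and> proots (map_poly complex_of_real p) = {#complex_of_real x1, z, cnj z#})"

end

theory Submission
  imports Defs
begin

text \<open>
  With \<open>y = x + a/3\<close> and \<open>s = sqrt (a\<^sup>2 - 3b) / 3\<close> the cubic becomes \<open>y\<^sup>3 - 3 s\<^sup>2 y + (c - c0)\<close>, whose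
  value at \<open>y = 2s\<close> is \<open>c - c2\<close> and at \<open>y = -2s\<close> is \<open>c - c1\<close>.  The intermediate value theorem thus
  yields a root \<open>r\<close> with \<open>\<bar>r\<bar> > 2s\<close>.  Dividing by \<open>y - r\<close> leaves a quadratic of discriminant
  \<open>3 (4 s\<^sup>2 - r\<^sup>2) < 0\<close>.
\<close>

text \<open>The negative discriminant gives the quadratic the non-real roots \<open>z\<close> and
  \<open>cnj z\<close>, read off from the quadratic formula. Factoring over the complex numbers
  settles the multiset of roots; completing the square settles the real zero set.\<close>

lemma only_one_real_root_linear_times_quadratic:
  fixes r u v :: real
  assumes "u\<^sup>2 < 4 * v"
  shows "only_one_real_root ([:-r, 1:] * [:v, u, 1:]) r"
proof -
  define d where "d = sqrt (4 * v - u\<^sup>2)"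
  have d: "d > 0" "d\<^sup>2 = 4 * v - u\<^sup>2"
    using assms by (simp_all add: d_def)
  define z where "z = Complex (- u / 2) (d / 2)"
  have "z \<notin> \<real>"
    using d by (simp add: z_def complex_is_Real_iff)
  have sum: "complex_of_real u = - (z + cnj z)"
    by (simp add: z_def complex_eq_iff)
  have "complex_of_real v = z * cnj z"
    using d by (simp add: z_def complex_eq_iff power2_eq_square field_simps)
  with sum have quad: "map_poly complex_of_real [:v, u, 1:] = [:-z, 1:] * [:-cnj z, 1:]"
    by (simp add: map_poly_pCons)
  have "map_poly complex_of_real ([:-r, 1:] * [:v, u, 1:])
      = map_poly complex_of_real [:-r, 1:] * map_poly complex_of_real [:v, u, 1:]"
    by (simp add: map_poly_pCons)
  also have "\<dots> = [:-complex_of_real r, 1:] * ([:-z, 1:] * [:-cnj z, 1:])"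
    by (simp only: quad) (simp add: map_poly_pCons)
  \<comment> \<open>The product must stay factored for \<open>proots_mult\<close> to collect the
    roots factor by factor, so the rules that would multiply it out are deleted.\<close>
  finally have "proots (map_poly complex_of_real ([:-r, 1:] * [:v, u, 1:]))
      = {#complex_of_real r, z, cnj z#}"
    by (simp add: proots_mult del: mult_pCons_left mult_pCons_right)
  moreover have "v + x * (u + x) > 0" for x
  proof -
    have "4 * (v + x * (u + x)) = (2 * x + u)\<^sup>2 + d\<^sup>2"
      unfolding d(2) by (simp add: power2_eq_square algebra_simps)
    moreover have "(2 * x + u)\<^sup>2 + d\<^sup>2 > 0"
      using d(1) by (simp add: add_nonneg_pos)
    ultimately show ?thesis
      by (metis zero_less_mult_pos zero_less_numeral)
  qed
  then have "{x. poly ([:-r, 1:] * [:v, u, 1:]) x = 0} = {r}"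
    by (auto simp: poly_mult less_imp_neq[symmetric] simp del: mult_pCons_left mult_pCons_right)
  ultimately show ?thesis
    unfolding only_one_real_root_def using \<open>z \<notin> \<real>\<close> by blast
qed

text \<open>Synthetic division by \<open>[:-r, 1:]\<close> gives the quadratic cofactor. Three times
  its discriminant equals \<open>4 * (a^2 - 3 * b) - (3 * r + a)^2\<close>, which explains the
  second hypothesis.\<close>

lemma only_one_real_root_cubic:
  fixes a b c r :: real
  assumes "poly [:c, b, a, 1:] r = 0" and "4 * (a\<^sup>2 - 3 * b) < (3 * r + a)\<^sup>2"
  shows "only_one_real_root [:c, b, a, 1:] r"
proof -
  have "c = - r * (b + r * (a + r))"
    using assms(1) by (simp add: algebra_simps)
  then have "[:c, b, a, 1:] = [:-r, 1:] * [:b + r * (a + r), a + r, 1:]"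
    by (simp add: algebra_simps)
  moreover have "(a + r)\<^sup>2 < 4 * (b + r * (a + r))"
    using assms(2) by (simp add: power2_eq_square algebra_simps)
  ultimately show ?thesis
    using only_one_real_root_linear_times_quadratic by metis
qed

lemma poly_root_greater:
  fixes p :: "real poly"
  assumes "lead_coeff p > 0" and "poly p t < 0"
  shows "\<exists>r>t. poly p r = 0"
proof -
  obtain n where "\<And>x. x \<ge> n \<Longrightarrow> poly p x \<ge> lead_coeff p"
    using poly_pinfty_gt_lc[OF assms(1)] by blast
  \<comment> \<open>Taking the maximum with \<open>t + 1\<close> puts the point strictly to the
    right of \<open>t\<close>, as the intermediate value theorem requires.\<close>
  then have "poly p (max n (t + 1)) > 0"
    using assms(1) by (meson max.cobounded1 less_le_trans)
  then show ?thesis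
    using poly_IVT_pos[of t "max n (t + 1)" p] assms(2) by force
qed

theorem theorem2:
  fixes a b c c0 c1 c2 \<mu>1 \<mu>2 \<xi>1 \<xi>2 :: real and p :: "real poly"
  assumes "b < a\<^sup>2 / 3"
    and "c0 = - (2 / 27) * a ^ 3 + (1 / 3) * a * b"
    and "c1 = c0 + (2 / 27) * sqrt ((a\<^sup>2 - 3 * b) ^ 3)"
    and "c2 = c0 - (2 / 27) * sqrt ((a\<^sup>2 - 3 * b) ^ 3)"
    and "\<mu>1 = - (a / 3) + (1 / 3) * sqrt (a\<^sup>2 - 3 * b)"
    and "\<mu>2 = - (a / 3) - (1 / 3) * sqrt (a\<^sup>2 - 3 * b)"
    and "\<xi>1 = - a - 2 * \<mu>1"
    and "\<xi>2 = - a - 2 * \<mu>2"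
    and "p = [:c, b, a, 1:]"
  shows "\<xi>2 = - (a / 3) + (2 / 3) * sqrt (a\<^sup>2 - 3 * b)
       \<and> \<xi>1 = - (a / 3) - (2 / 3) * sqrt (a\<^sup>2 - 3 * b)
       \<and> (c < c2 \<longrightarrow> (\<exists>x1. only_one_real_root p x1 \<and> x1 > \<xi>2))
       \<and> (c > c1 \<longrightarrow> (\<exists>x1. only_one_real_root p x1 \<and> x1 < \<xi>1))"
proof -
  define s where "s = sqrt (a\<^sup>2 - 3 * b) / 3"
  have s: "s > 0" "sqrt (a\<^sup>2 - 3 * b) = 3 * s"
    using assms(1) by (simp_all add: s_def)
  have s2: "a\<^sup>2 - 3 * b = 9 * s\<^sup>2"
    using assms(1) by (simp add: s_def power_divide)
  \<comment> \<open>Eliminating \<open>b\<close> in favour of \<open>s\<close> turns the values of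
    \<open>p\<close> at \<open>\<xi>1\<close> and \<open>\<xi>2\<close> into polynomial identities
    in \<open>a\<close>, \<open>s\<close> and \<open>c\<close>, free of square roots.\<close>
  have b: "b = a\<^sup>2 / 3 - 3 * s\<^sup>2"
    using s2 by simp
  have c: "c1 = c0 + 2 * s ^ 3" "c2 = c0 - 2 * s ^ 3"
    by (simp_all add: assms(3,4) real_sqrt_power s(2) power_mult_distrib)
  have \<xi>: "\<xi>1 = - (a / 3) - 2 * s" "\<xi>2 = - (a / 3) + 2 * s"
    by (simp_all add: assms(5-8) s(2))
  have disc: "4 * (a\<^sup>2 - 3 * b) < (3 * x + a)\<^sup>2" if "\<bar>x + a / 3\<bar> > 2 * s" for x
  proof -
    have "(2 * s)\<^sup>2 < (x + a / 3)\<^sup>2"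
      using that s(1) by (metis abs_le_square_iff abs_of_pos linorder_not_less mult_pos_pos zero_less_numeral)
    then show ?thesis
      unfolding s2 by (simp add: power2_eq_square field_simps)
  qed
  have "\<exists>x1. only_one_real_root p x1 \<and> x1 > \<xi>2" if "c < c2"
  proof -
    have "poly p \<xi>2 = c - c2"
      unfolding assms(9) \<xi> c assms(2) b by (simp add: field_simps power2_eq_square power3_eq_cube)
    with that have "poly p \<xi>2 < 0"
      by simp
    then obtain r where r: "r > \<xi>2" "poly p r = 0"
      using poly_root_greater[of p \<xi>2] by (auto simp: assms(9))
    have "\<bar>r + a / 3\<bar> > 2 * s"
      using r(1) \<xi>(2) by linarith
    then show ?thesis
      using only_one_real_root_cubic disc r assms(9) by blast
  qed
  moreover have "\<exists>x1. only_one_real_root p x1 \<and> x1 < \<xi>1" if "c > c1"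
  proof -
    \<comment> \<open>The reflection \<open>q(x) = - p(-x)\<close> is again a monic cubic, so a root
      of \<open>q\<close> to the right of \<open>- \<xi>1\<close> is the negative of a root of
      \<open>p\<close> to the left of \<open>\<xi>1\<close>.\<close>
    define q where "q = [:- c, b, - a, 1:]"
    have q: "poly q x = - poly p (- x)" for x
      by (simp add: q_def assms(9) algebra_simps)
    have "poly p \<xi>1 = c - c1"
      unfolding assms(9) \<xi> c assms(2) b by (simp add: field_simps power2_eq_square power3_eq_cube)
    with that have "poly q (- \<xi>1) < 0"
      by (simp add: q)
    then obtain r where r: "r > - \<xi>1" "poly q r = 0"
      using poly_root_greater[of q "- \<xi>1"] by (auto simp: q_def)
    have "\<bar>- r + a / 3\<bar> > 2 * s"
      using r(1) \<xi>(1) by linarith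
    then have "only_one_real_root p (- r)"
      using only_one_real_root_cubic disc r(2) q assms(9) by force
    then show ?thesis
      using r(1) by (metis minus_less_iff)
  qed
  ultimately show ?thesis
    by (simp add: \<xi> s(2))
qed

end
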